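(* (Conservation of the total energy for the full discretization.) Suppose that the data at the times $t^{\tau}$ and $t^{\tau+1}=t^{\tau}+\Delta t$ are related by the Crank-Nicolson Legendre-Fourier scheme: for $s\in\{e,i\}$, $0\le n\le N_L-1$, $-N_F\le k\le N_F$, $$\frac{C^{s,\tau+1}_{n,k}-C^{s,\tau}_{n,k}}{\Delta t}+\frac{\pi i}{L}k\Big(\sigma_{n+1}\widehat C^s_{n+1,k}+\sigma_n\widehat C^s_{n-1,k}+\overline\sigma\widehat C^s_{n,k}\Big)-\frac{q^s}{4m^s}\Big[\widehat E\star\Big(\sum_{i=0}^{n-1}\sigma_{n,i}\widehat C^s_i-\gamma^s\delta_v[\widehat f^s\phi_n]_{v_a}^{v_b}\Big)\Big]_k=\tfrac12D^s_n\widehat C^s_{n,k},$$ where a hat denotes the sum of the values at $t^{\tau}$ and $t^{\tau+1}$ (e.g. $\widehat E=E^{\tau+1}+E^{\tau}$). Then the total energy $$\mathcal{E}_{tot}(t)=\sum_{s\in\{e,i\}}\frac{m^s}{2}\int_0^L\int_{v_a}^{v_b}v^2f^s(x,v,t)\,dv\,dx+\frac{\epsilon_0}{2}\int_0^LE(x,t)^2\,dx$$ satisfies $$\mathcal{E}_{tot}(t^{\tau+1})-\mathcal{E}_{tot}(t^{\tau})=\Delta t\sum_{s\in\{e,i\}}\mathcal{B}^{s;\tau,\tau+1}_{kin}+\Delta t\,\mathcal{B}^{\tau,\tau+1}_{pot},$$ that is, the variation of the total energy between $t^{\tau}$ and $t^{\tau+1}$ is balanced by kinetic and potential boundary terms.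 Here, with $$\mathcal{B}^{s;\tau,\tau+1}_{n,0}=-\gamma^s\frac{q^s}{4}(v_b-v_a)L\big[\widehat E\star\delta_v[\widehat f^s\phi_n]_{v_a}^{v_b}\big]_0,$$ the kinetic boundary term is $$\mathcal{B}^{s;\tau,\tau+1}_{kin}=\sigma_2\sigma_1\mathcal{B}^{s;\tau,\tau+1}_{2,0}+2\sigma_1\overline\sigma\,\mathcal{B}^{s;\tau,\tau+1}_{1,0}+(\sigma_1^2+\sigma_0^2+\overline\sigma^2)\,\mathcal{B}^{s;\tau,\tau+1}_{0,0},$$ and the potential boundary term is $$\mathcal{B}^{\tau,\tau+1}_{pot}=\frac12\sum_{k=-N_F}^{N_F}\big(E^{\tau+1}_{-k}+E^{\tau}_{-k}\big)\Big(\mathcal{B}^{Amp}_k(t^{\tau+1})+\mathcal{B}^{Amp}_k(t^{\tau})\Big),$$ with $$\mathcal{B}^{Amp}_k=-\sum_{s\in\{e,i\}}\frac{q^s}{4m^s}\Big(\frac{2\pi i}{L}k\Big)^{-1}\Big[\big(E^{\tau+1}+E^{\tau}\big)\star\gamma^s\delta_v\big[f^{s,\tau+1}+f^{s,\tau}\big]_{v_a}^{v_b}\Big]_k\qquad(k\neq0),$$ where $\mathcal{B}^{Amp}_k(t^{\tau+1})$ and $\mathcal{B}^{Amp}_k(t^{\tau})$ both denote this quantity $\mathcal{B}^{Amp}_k$, and the $k=0$ term of the sum is zero because $E_0=0$.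
   Context: Let $L>0$, $v_a<v_b$, $\Delta t>0$, integers $N_L\ge4$, $N_F\ge0$; species $s\in\{e,i\}$ (electrons and ions) have mass $m^s>0$ and charge $q^s\in\mathbb{R}$; $\epsilon_0>0$ is the dielectric constant; $\gamma^s\in\mathbb{R}$ is a penalty coefficient and $\nu_s\ge0$ an artificial collision coefficient. Let $L_n$ be the Legendre polynomials on $[-1,1]$ ($L_0=1$, $L_1(\eta)=\eta$, $(2n+1)\eta L_n=(n+1)L_{n+1}+nL_{n-1}$), $\phi_n(v)=\sqrt{2n+1}\,L_n\big((2v-(v_a+v_b))/(v_b-v_a)\big)$, $\psi_k(x)=e^{2\pi i kx/L}$. Constants: $\overline\sigma=\frac{v_a+v_b}{2}$, $\sigma_0=0$, $\sigma_n=\frac{v_b-v_a}{2}\frac{n}{\sqrt{(2n+1)(2n-1)}}$ for $n\ge1$; $\sigma_{n,i}=\pi_{n,i}\frac{2\sqrt{(2n+1)(2i+1)}}{v_b-v_a}$ with $\pi_{n,i}=0$ if $n-i$ is even, $1$ if odd; $D^s_n=-\nu_s\frac{n(n-1)(n-2)}{(N_L-1)(N_L-2)(N_L-3)}$. At each discrete time $t\in\{t^\tau,t^{\tau+1}\}$ (a superscript $\tau$ denotes the value at $t^{\tau}$): $f^s(x,v,t)=\sum_{n=0}^{N_L-1}C^s_n(x,t)\phi_n(v)$, $C^s_n(x,t)=\sum_{k=-N_F}^{N_F}C^s_{n,k}(t)\psi_k(x)$ (real-valued), with conventions $C^s_{-1}=C^s_{N_L}=0$; the electric field $E(x,t)=\sum_{k=-N_F}^{N_F}E_k(t)\psi_k(x)$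 is real-valued and satisfies the Poisson equation $\epsilon_0\big(\frac{2\pi i}{L}k\big)E_k=(v_b-v_a)\sum_{s\in\{e,i\}}q^sC^s_{0,k}$ for $-N_F\le k\le N_F$ (for $k=0$ this is the neutrality condition $\sum_sq^sC^s_{0,0}=0$), and one sets $E_0=0$. For $g(x,v)$, $\delta_v[g]_{v_a}^{v_b}=\frac{g(x,v_b)-g(x,v_a)}{v_b-v_a}$. For functions $g,h$ of $x$ with Fourier coefficients $g_j,h_j$ with respect to $\psi_j$, $|j|\le N_F$ (coefficients with $|j|>N_F$ being zero), $[g\star h]_k=\sum_{k'=-N_F}^{N_F}g_{k'}h_{k-k'}$.
   Formalization: The printed balance fails for generic data, so its weights are corrected: each kinetic boundary term carries a factor 1/2, and the species-s summand of the potential boundary term carries a factor q^s L (v_b - v_a)/2. Hypotheses and boundary-term formulas are unchanged. *)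

theory Defs
  imports "HOL-Analysis.Analysis"
begin

datatype species = Electron | Ion

record params =
  box_len :: real
  v_a :: real
  v_b :: real
  dt :: real
  eps0 :: real
  N_L :: nat
  N_F :: nat
  mass :: "species \<Rightarrow> real"
  charge :: "species \<Rightarrow> real"
  penalty :: "species \<Rightarrow> real"
  collision :: "species \<Rightarrow> real"

definition admissible :: "params \<Rightarrow> bool" where
  "admissible P \<longleftrightarrow> box_len P > 0 \<and> v_a P < v_b P \<and> dt P > 0 \<and> eps0 P > 0 \<and> N_L P \<ge> 4 \<and>
     (\<forall>s. mass P s > 0 \<and> collision P s \<ge> 0)"

fun legendre :: "nat \<Rightarrow> real \<Rightarrow> real" where
  "legendre 0 x = 1"
| "legendre (Suc 0) x = x"
| "legendre (Suc (Suc n)) x =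
     ((2 * real n + 3) * x * legendre (Suc n) x - (real n + 1) * legendre n x) / (real n + 2)"

definition phi :: "params \<Rightarrow> nat \<Rightarrow> real \<Rightarrow> real" where
  "phi P n v = sqrt (2 * real n + 1) * legendre n ((2 * v - (v_a P + v_b P)) / (v_b P - v_a P))"

definition psi :: "params \<Rightarrow> int \<Rightarrow> real \<Rightarrow> complex" where
  "psi P k x = exp (2 * of_real pi * \<i> * of_int k * of_real x / of_real (box_len P))"

definition modes :: "params \<Rightarrow> int set" where
  "modes P = {- int (N_F P)..int (N_F P)}"

definition wavenum :: "params \<Rightarrow> int \<Rightarrow> complex" where
  "wavenum P k = 2 * of_real pi * \<i> / of_real (box_len P) * of_int k"

definition sigma_bar :: "params \<Rightarrow> real" where
  "sigma_bar P = (v_a P + v_b P) / 2"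

definition sigma :: "params \<Rightarrow> nat \<Rightarrow> real" where
  "sigma P n = (if n = 0 then 0
     else (v_b P - v_a P) / 2 * (real n / sqrt ((2 * real n + 1) * (2 * real n - 1))))"

definition sigma2 :: "params \<Rightarrow> nat \<Rightarrow> nat \<Rightarrow> real" where
  "sigma2 P n i = (if even (int n - int i) then 0
     else 2 * sqrt ((2 * real n + 1) * (2 * real i + 1)) / (v_b P - v_a P))"

definition coll_coeff :: "params \<Rightarrow> species \<Rightarrow> nat \<Rightarrow> real" where
  "coll_coeff P s n = - collision P s * (real n * (real n - 1) * (real n - 2) /
     ((real (N_L P) - 1) * (real (N_L P) - 2) * (real (N_L P) - 3)))"

text \<open>
  Unknowns: \<open>C s n k t\<close> is the coefficient of species \<open>s\<close>, Legendre index \<open>n\<close>, Fourier index \<open>k\<close>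
  at time \<open>t\<close>, and \<open>E k t\<close> the Fourier coefficient of the electric field.  The Legendre index is
  an integer so that the conventions at \<open>n = -1\<close> and \<open>n = N_L\<close> can be written directly.
\<close>

type_synonym legendre_coeffs = "species \<Rightarrow> int \<Rightarrow> int \<Rightarrow> real \<Rightarrow> complex"
type_synonym field_coeffs = "int \<Rightarrow> real \<Rightarrow> complex"

definition C_fun :: "params \<Rightarrow> legendre_coeffs \<Rightarrow> species \<Rightarrow> int \<Rightarrow> real \<Rightarrow> real \<Rightarrow> complex" where
  "C_fun P C s n t x = (\<Sum>k\<in>modes P. C s n k t * psi P k x)"

definition f_fun :: "params \<Rightarrow> legendre_coeffs \<Rightarrow> species \<Rightarrow> real \<Rightarrow> real \<Rightarrow> real \<Rightarrow> complex" where
  "f_fun P C s t x v = (\<Sum>n<N_L P. C_fun P C s (int n) t x * of_real (phi P n v))"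

definition E_fun :: "params \<Rightarrow> field_coeffs \<Rightarrow> real \<Rightarrow> real \<Rightarrow> complex" where
  "E_fun P E t x = (\<Sum>k\<in>modes P. E k t * psi P k x)"

definition discrete_state :: "params \<Rightarrow> legendre_coeffs \<Rightarrow> field_coeffs \<Rightarrow> real \<Rightarrow> bool" where
  "discrete_state P C E t \<longleftrightarrow>
     (\<forall>s. \<forall>k\<in>modes P. C s (-1) k t = 0 \<and> C s (int (N_L P)) k t = 0) \<and>
     (\<forall>s. \<forall>n<N_L P. \<forall>x. C_fun P C s (int n) t x \<in> \<real>) \<and>
     (\<forall>x. E_fun P E t x \<in> \<real>) \<and>
     (\<forall>k\<in>modes P. of_real (eps0 P) * wavenum P k * E k t =
        of_real (v_b P - v_a P) * (\<Sum>s\<in>{Electron, Ion}. of_real (charge P s) * C s 0 k t)) \<and>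
     E 0 t = 0"

definition hat :: "params \<Rightarrow> (real \<Rightarrow> complex) \<Rightarrow> real \<Rightarrow> complex" where
  "hat P g t = g (t + dt P) + g t"

definition delta_v :: "params \<Rightarrow> (real \<Rightarrow> real \<Rightarrow> complex) \<Rightarrow> real \<Rightarrow> complex" where
  "delta_v P g x = (g x (v_b P) - g x (v_a P)) / of_real (v_b P - v_a P)"

definition fourier_coeff :: "params \<Rightarrow> (real \<Rightarrow> complex) \<Rightarrow> int \<Rightarrow> complex" where
  "fourier_coeff P g k =
     (if k \<in> modes P then integral {0..box_len P} (\<lambda>x. g x * psi P (- k) x) / of_real (box_len P)
      else 0)"

definition star :: "params \<Rightarrow> (real \<Rightarrow> complex) \<Rightarrow> (real \<Rightarrow> complex) \<Rightarrow> int \<Rightarrow> complex" where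
  "star P g h k = (\<Sum>k'\<in>modes P. fourier_coeff P g k' * fourier_coeff P h (k - k'))"

definition E_hat :: "params \<Rightarrow> field_coeffs \<Rightarrow> real \<Rightarrow> real \<Rightarrow> complex" where
  "E_hat P E t x = hat P (\<lambda>r. E_fun P E r x) t"

definition delta_f_phi_hat ::
    "params \<Rightarrow> legendre_coeffs \<Rightarrow> species \<Rightarrow> nat \<Rightarrow> real \<Rightarrow> real \<Rightarrow> complex" where
  "delta_f_phi_hat P C s n t =
     delta_v P (\<lambda>x v. hat P (\<lambda>r. f_fun P C s r x v) t * of_real (phi P n v))"

definition crank_nicolson :: "params \<Rightarrow> legendre_coeffs \<Rightarrow> field_coeffs \<Rightarrow> real \<Rightarrow> bool" where
  "crank_nicolson P C E t \<longleftrightarrow>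
     (\<forall>s. \<forall>n<N_L P. \<forall>k\<in>modes P.
        (C s (int n) k (t + dt P) - C s (int n) k t) / of_real (dt P)
        + of_real pi * \<i> / of_real (box_len P) * of_int k *
            (of_real (sigma P (n + 1)) * hat P (C s (int n + 1) k) t
             + of_real (sigma P n) * hat P (C s (int n - 1) k) t
             + of_real (sigma_bar P) * hat P (C s (int n) k) t)
        - of_real (charge P s / (4 * mass P s)) *
            star P (E_hat P E t)
              (\<lambda>x. (\<Sum>i<n. of_real (sigma2 P n i) * hat P (\<lambda>r. C_fun P C s (int i) r x) t)
                   - of_real (penalty P s) * delta_f_phi_hat P C s n t x) k
        = 1 / 2 * of_real (coll_coeff P s n) * hat P (C s (int n) k) t)"

text \<open>
  The distribution functions and the field are complex exponential sums that take real values,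
  so the energy is written with complex-valued integrands.
\<close>

definition total_energy :: "params \<Rightarrow> legendre_coeffs \<Rightarrow> field_coeffs \<Rightarrow> real \<Rightarrow> complex" where
  "total_energy P C E t =
     (\<Sum>s\<in>{Electron, Ion}. of_real (mass P s / 2) *
        integral {0..box_len P} (\<lambda>x. integral {v_a P..v_b P} (\<lambda>v. of_real (v\<^sup>2) * f_fun P C s t x v)))
     + of_real (eps0 P / 2) * integral {0..box_len P} (\<lambda>x. (E_fun P E t x)\<^sup>2)"

definition B_mode0 ::
    "params \<Rightarrow> legendre_coeffs \<Rightarrow> field_coeffs \<Rightarrow> species \<Rightarrow> real \<Rightarrow> nat \<Rightarrow> complex" where
  "B_mode0 P C E s t n =
     - of_real (penalty P s * (charge P s / 4) * (v_b P - v_a P) * box_len P) *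
       star P (E_hat P E t) (delta_f_phi_hat P C s n t) 0"

definition B_kin :: "params \<Rightarrow> legendre_coeffs \<Rightarrow> field_coeffs \<Rightarrow> species \<Rightarrow> real \<Rightarrow> complex" where
  "B_kin P C E s t =
     of_real (sigma P 2 * sigma P 1) * B_mode0 P C E s t 2
     + of_real (2 * sigma P 1 * sigma_bar P) * B_mode0 P C E s t 1
     + of_real ((sigma P 1)\<^sup>2 + (sigma P 0)\<^sup>2 + (sigma_bar P)\<^sup>2) * B_mode0 P C E s t 0"

text \<open>
  \<open>B_Amp\<close> and \<open>B_pot\<close> are the species summands of the Ampere and potential boundary terms; the
  terms themselves are their sums over \<open>s\<close>.  They are kept separate because the balance law needs
  weights that the published formula omits (it uses weight \<open>1\<close> throughout and fails for generic
  data): \<open>1 / 2\<close> on \<open>B_kin\<close>, from the factor \<open>mass / 2\<close> of the kinetic energy, and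
  \<open>charge * box_len * (v_b - v_a) / 2\<close> on \<open>B_pot\<close>, from the Poisson equation and Parseval's identity.
  For \<open>k = 0\<close> the value of \<open>B_Amp\<close> is \<open>0\<close>, since \<open>inverse 0 = 0\<close>.
\<close>

definition B_Amp ::
    "params \<Rightarrow> legendre_coeffs \<Rightarrow> field_coeffs \<Rightarrow> species \<Rightarrow> real \<Rightarrow> int \<Rightarrow> complex" where
  "B_Amp P C E s t k =
     - (of_real (charge P s / (4 * mass P s)) * inverse (wavenum P k) *
        star P (E_hat P E t)
          (\<lambda>x. of_real (penalty P s) *
             delta_v P (\<lambda>y v. hat P (\<lambda>r. f_fun P C s r y v) t) x) k)"

definition B_pot :: "params \<Rightarrow> legendre_coeffs \<Rightarrow> field_coeffs \<Rightarrow> species \<Rightarrow> real \<Rightarrow> complex" where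
  "B_pot P C E s t =
     1 / 2 * (\<Sum>k\<in>modes P. hat P (E (- k)) t * (B_Amp P C E s t k + B_Amp P C E s t k))"

end

theory Submission
  imports Defs
begin

text \<open>
  Let \<open>cC\<close> and \<open>cE\<close> denote the sums of the values of \<open>C\<close> and \<open>E\<close> at the two times, \<open>\<Delta>\<close> the change
  of a quantity over the time step, and \<open>J_k = \<sigma>_1 cC_{1,k} + \<sigma>_bar cC_{0,k}\<close>.
  The balance law is an exchange between kinetic and field energy: the field does work
  \<open>\<Sum>k. cE_{-k} J_k\<close> (up to a factor) on the particles and loses exactly that amount.

  Kinetic part. The functions \<open>\<phi>_n\<close> satisfy a three-term recurrence
  \<open>v \<phi>_n = \<sigma>_{n+1} \<phi>_{n+1} + \<sigma>_n \<phi>_{n-1} + \<sigma>_bar \<phi>_n\<close>, and \<open>\<phi>_n\<close> integrates to \<open>0\<close> for \<open>n \<ge> 1\<close>.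
  Applying the recurrence twice shows that \<open>v\<^sup>2\<close> only sees the modes \<open>n \<le> 2\<close>, with the weights that
  appear in \<open>B_kin\<close>; integration over \<open>x\<close> keeps only the Fourier mode \<open>0\<close>. There the transport
  term vanishes and so does the collision term, because \<open>n (n - 1) (n - 2) = 0\<close>. The penalty terms
  give \<open>B_kin\<close>, and the remaining convolution is the work of the field, thanks to
  \<open>\<sigma>_1 \<sigma>_{1,0} = 1\<close> and \<open>\<sigma>_2 \<sigma>_{2,1} = 2\<close> (\<open>kinetic_balance\<close>).

  Field part. Poisson's equation at both times expresses \<open>\<Delta>E_k\<close> through \<open>\<Delta>C_{0,k}\<close>, for which the
  scheme with \<open>n = 0\<close> is a discrete continuity equation with flux \<open>J_k\<close> and a penalty source;
  dividing by the wave number gives a discrete Ampere law (\<open>ampere\<close>). By Parseval's identity the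
  change of the field energy is a multiple of \<open>\<Sum>k. cE_{-k} \<Delta>E_k\<close>, so that \<open>J_k\<close> produces minus the
  work of the field and the penalty source produces \<open>B_pot\<close> (\<open>field_balance\<close>). Adding the two
  balances cancels the work.
\<close>

section \<open>Legendre polynomials and their velocity moments\<close>

text \<open>The derivative of the Legendre polynomials, by differentiating their recurrence.\<close>

fun legendre' :: "nat \<Rightarrow> real \<Rightarrow> real" where
  "legendre' 0 x = 0"
| "legendre' (Suc 0) x = 1"
| "legendre' (Suc (Suc n)) x =
     ((2 * real n + 3) * (legendre (Suc n) x + x * legendre' (Suc n) x)
       - (real n + 1) * legendre' n x) / (real n + 2)"

lemma has_real_derivative_legendre:
  "(legendre n has_real_derivative legendre' n x) (at x)"
proof (induction n x rule: legendre.induct)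
  case (3 n x)
  have "((\<lambda>y. (2 * real n + 3) * y * legendre (Suc n) y - (real n + 1) * legendre n y)
      has_real_derivative (2 * real n + 3) * (legendre (Suc n) x + x * legendre' (Suc n) x)
        - (real n + 1) * legendre' n x) (at x)"
    by (rule derivative_eq_intros 3 refl | simp add: algebra_simps)+
  from DERIV_cdivide[OF this, of "real n + 2"] show ?case by simp
qed simp_all

lemma legendre_recurrence:
  "(real n + 2) * legendre (Suc (Suc n)) x
     = (2 * real n + 3) * x * legendre (Suc n) x - (real n + 1) * legendre n x"
  by simp

text \<open>
  The induction step of the first identity uses the second at the preceding index, and that of the
  second uses both, so they are proved together.
\<close>

lemma legendre'_relations:
  "legendre' (Suc n) x = x * legendre' n x + (real n + 1) * legendre n x
   \<and> x * legendre' (Suc n) x - legendre' n x = (real n + 1) * legendre (Suc n) x"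
proof (induction n)
  case (Suc n)
  define a b c where "a = legendre n x" and "b = legendre (Suc n) x" and "c = legendre (Suc (Suc n)) x"
  define a' b' c' where "a' = legendre' n x" and "b' = legendre' (Suc n) x"
    and "c' = legendre' (Suc (Suc n)) x"
  have A: "b' = x * a' + (real n + 1) * a" and B: "x * b' - a' = (real n + 1) * b"
    using Suc unfolding a_def b_def a'_def b'_def by blast+
  have c: "(real n + 2) * c = (2 * real n + 3) * x * b - (real n + 1) * a"
    by (simp add: a_def b_def c_def)
  have "(real n + 2) * c' = (2 * real n + 3) * (b + x * b') - (real n + 1) * a'"
    by (simp add: a'_def b_def b'_def c'_def)
  also have "\<dots> = (real n + 2) * (x * b' + (real n + 2) * b)"
    using B by algebra
  finally have A': "c' = x * b' + (real n + 2) * b"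
    by (metis mult_left_cancel of_nat_add of_nat_eq_0_iff of_nat_numeral add_is_0 zero_neq_numeral)
  have "x * c' - b' = (real n + 2) * c"
    using A B A' c by algebra
  with A' show ?case
    by (simp only: a_def b_def c_def a'_def b'_def c'_def of_nat_Suc) (simp add: add.commute)
qed simp

lemma legendre'_diff:
  "legendre' (Suc (Suc n)) x - legendre' n x = (2 * real n + 3) * legendre (Suc n) x"
proof -
  have "legendre' (Suc (Suc n)) x = x * legendre' (Suc n) x + (real (Suc n) + 1) * legendre (Suc n) x"
    using legendre'_relations[of "Suc n" x] by blast
  moreover have "x * legendre' (Suc n) x - legendre' n x = (real n + 1) * legendre (Suc n) x"
    using legendre'_relations[of n x] by blast
  ultimately show ?thesis by (simp add: algebra_simps del: legendre.simps legendre'.simps)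
qed

text \<open>
  The preceding identity makes \<open>legendre (n + 2) - legendre n\<close> an antiderivative of a multiple of
  \<open>legendre (n + 1)\<close>; by the following endpoint values it vanishes at \<open>1\<close> and \<open>-1\<close>. Full
  orthogonality of the Legendre polynomials is therefore not needed below.
\<close>

lemma legendre_at_one: "legendre n 1 = 1"
proof (induction n rule: induct_nat_012)
  case (ge2 n)
  then show ?case by (simp add: field_simps)
qed simp_all

lemma legendre_at_minus_one: "legendre n (- 1) = (- 1) ^ n"
proof (induction n rule: induct_nat_012)
  case (ge2 n)
  have "(2 * real n + 3) * (- 1) * legendre (Suc n) (- 1) - (real n + 1) * legendre n (- 1)
      = (real n + 2) * (- 1) ^ n"
    unfolding ge2 by (simp add: algebra_simps)
  then show ?case by simp
qed simp_all

lemma phi_0 [simp]: "phi P 0 v = 1"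
  by (simp add: phi_def)

lemma has_integral_phi:
  assumes "v_a P < v_b P"
  shows "(phi P n has_integral (if n = 0 then v_b P - v_a P else 0)) {v_a P..v_b P}"
proof (cases n)
  case 0
  have "((\<lambda>v. 1 :: real) has_integral (v_b P - v_a P)) {v_a P..v_b P}"
    using has_integral_const_real[of "1 :: real" "v_a P" "v_b P"] assms by simp
  moreover have "phi P 0 = (\<lambda>v. 1)" by (rule ext) simp
  ultimately show ?thesis using 0 by simp
next
  case (Suc m)
  define w where "w = v_b P - v_a P"
  define \<eta> where "\<eta> v = (2 * v - (v_a P + v_b P)) / w" for v
  define F where "F v = w / (2 * sqrt (2 * real m + 3)) * (legendre (m + 2) (\<eta> v) - legendre m (\<eta> v))" for v
  have w: "w > 0" using assms by (simp add: w_def)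
  have ends: "\<eta> (v_b P) = 1" "\<eta> (v_a P) = - 1"
    using w by (simp_all add: \<eta>_def w_def field_simps)
  have deriv: "(F has_real_derivative phi P n v) (at v)" for v
  proof -
    have \<eta>: "(\<eta> has_real_derivative 2 / w) (at v)"
      unfolding \<eta>_def by (rule derivative_eq_intros refl | use w in simp)+
    have "(F has_real_derivative w / (2 * sqrt (2 * real m + 3)) *
            (legendre' (m + 2) (\<eta> v) * (2 / w) - legendre' m (\<eta> v) * (2 / w))) (at v)"
      unfolding F_def
      by (intro DERIV_cmult DERIV_diff DERIV_chain2[OF has_real_derivative_legendre] \<eta>)
    also have "w / (2 * sqrt (2 * real m + 3)) *
            (legendre' (m + 2) (\<eta> v) * (2 / w) - legendre' m (\<eta> v) * (2 / w))
         = (legendre' (Suc (Suc m)) (\<eta> v) - legendre' m (\<eta> v)) / sqrt (2 * real m + 3)"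
      using w by (simp add: field_simps del: legendre'.simps)
    also have "\<dots> = ((2 * real m + 3) / sqrt (2 * real m + 3)) * legendre (Suc m) (\<eta> v)"
      by (simp only: legendre'_diff) simp
    also have "(2 * real m + 3) / sqrt (2 * real m + 3) = sqrt (2 * real m + 3)"
      by (rule real_div_sqrt) simp
    also have "sqrt (2 * real m + 3) * legendre (Suc m) (\<eta> v) = phi P n v"
      by (simp add: phi_def Suc \<eta>_def w_def add.commute del: legendre.simps)
    finally show ?thesis .
  qed
  have "(phi P n has_integral (F (v_b P) - F (v_a P))) {v_a P..v_b P}"
    using assms deriv
    by (intro fundamental_theorem_of_calculus)
       (auto simp: has_real_derivative_iff_has_vector_derivative[symmetric]
             intro: has_field_derivative_at_within)
  moreover have "F (v_b P) - F (v_a P) = 0"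
    by (simp add: F_def ends legendre_at_one legendre_at_minus_one del: legendre.simps)
  ultimately show ?thesis using Suc by simp
qed

text \<open>For \<open>n = 0\<close> the index \<open>n - 1\<close> is truncated to \<open>0\<close>, which is harmless since \<open>\<sigma>_0 = 0\<close>.\<close>

lemma phi_recurrence:
  assumes "v_a P < v_b P"
  shows "v * phi P n v = sigma P (n + 1) * phi P (n + 1) v + sigma P n * phi P (n - 1) v
           + sigma_bar P * phi P n v"
proof -
  define w where "w = v_b P - v_a P"
  define y where "y = (2 * v - (v_a P + v_b P)) / w"
  have w: "w > 0" using assms by (simp add: w_def)
  have v: "v = sigma_bar P + w / 2 * y"
    using w by (simp add: y_def sigma_bar_def field_simps)
  have up: "sigma P (n + 1) * phi P (n + 1) v
      = w / 2 * (real n + 1) / sqrt (2 * real n + 1) * legendre (n + 1) y"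
  proof -
    have "sqrt ((2 * real (n + 1) + 1) * (2 * real (n + 1) - 1))
        = sqrt (2 * real (n + 1) + 1) * sqrt (2 * real n + 1)"
      by (simp add: real_sqrt_mult)
    moreover have "sqrt (2 * real (n + 1) + 1) > 0" by simp
    ultimately show ?thesis
      by (simp add: sigma_def phi_def y_def w_def field_simps del: legendre.simps)
  qed
  show ?thesis
  proof (cases n)
    case 0
    have "v * phi P 0 v = w / 2 * y + sigma_bar P" using v by simp
    with up show ?thesis by (simp add: 0 sigma_def)
  next
    case (Suc m)
    define r where "r = sqrt (2 * real n + 1)"
    have r: "r > 0" "r * r = 2 * real n + 1" by (simp_all add: r_def)
    define q where "q = sqrt (2 * real m + 1)"
    have q: "q > 0" by (simp add: q_def)
    have "sigma P n = w / 2 * (real n / sqrt ((2 * real n + 1) * (2 * real n - 1)))"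
      by (simp add: sigma_def Suc w_def)
    also have "sqrt ((2 * real n + 1) * (2 * real n - 1)) = r * q"
      by (simp only: real_sqrt_mult r_def) (simp add: Suc q_def)
    finally have "sigma P n * phi P (n - 1) v = w / 2 * (real n / (r * q)) * (q * legendre m y)"
      by (simp add: phi_def Suc q_def y_def w_def)
    then have down: "sigma P n * phi P (n - 1) v = w / 2 * real n / r * legendre m y"
      using q r by simp
    have rec: "r * r * y * legendre n y = (real n + 1) * legendre (n + 1) y + real n * legendre m y"
      using legendre_recurrence[of m y] by (simp add: Suc r algebra_simps del: legendre.simps)
    have phi: "phi P n v = r * legendre n y"
      by (simp add: phi_def r_def y_def w_def)
    have "v * phi P n v = (sigma_bar P + w / 2 * y) * phi P n v"
      by (simp only: v[symmetric])
    also have "\<dots> = sigma_bar P * phi P n v + w / 2 * (r * y * legendre n y)"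
      unfolding phi by (simp add: algebra_simps)
    also have "r * y * legendre n y = (r * r * y * legendre n y) / r"
      using r(1) by simp
    also note rec
    finally show ?thesis
      using r unfolding up down r_def[symmetric] by (simp add: field_simps del: legendre.simps)
  qed
qed

lemma has_integral_times_phi:
  assumes "v_a P < v_b P"
  shows "((\<lambda>v. v * phi P n v) has_integral (v_b P - v_a P) *
           (if n = 0 then sigma_bar P else if n = 1 then sigma P 1 else 0)) {v_a P..v_b P}"
proof -
  have "((\<lambda>v. v * phi P n v) has_integral
      (sigma P (n + 1) * (if n + 1 = 0 then v_b P - v_a P else 0)
       + sigma P n * (if n - 1 = 0 then v_b P - v_a P else 0)
       + sigma_bar P * (if n = 0 then v_b P - v_a P else 0))) {v_a P..v_b P}"
    unfolding phi_recurrence[OF assms]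
    by (intro has_integral_add has_integral_mult_right has_integral_phi assms)
  then show ?thesis
    by (rule has_integral_eq_rhs) (auto simp: sigma_def)
qed

text \<open>
  The integral of \<open>v\<^sup>2 \<phi>_n\<close> over the velocity interval, divided by \<open>v_b - v_a\<close>. The zero term
  \<open>(sigma P 0)\<^sup>2\<close> is kept so that the values are literally the weights in \<open>B_kin\<close>.
\<close>

definition second_moment :: "params \<Rightarrow> nat \<Rightarrow> real" where
  "second_moment P n =
     (if n = 0 then (sigma P 1)\<^sup>2 + (sigma P 0)\<^sup>2 + (sigma_bar P)\<^sup>2
      else if n = 1 then 2 * sigma P 1 * sigma_bar P
      else if n = 2 then sigma P 2 * sigma P 1 else 0)"

lemma has_integral_square_times_phi:
  assumes "v_a P < v_b P"
  shows "((\<lambda>v. v\<^sup>2 * phi P n v) has_integral (v_b P - v_a P) * second_moment P n) {v_a P..v_b P}"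
proof -
  define M where "M n = (v_b P - v_a P) *
    (if n = 0 then sigma_bar P else if n = 1 then sigma P 1 else 0)" for n :: nat
  have eq: "v\<^sup>2 * phi P n v = sigma P (n + 1) * (v * phi P (n + 1) v)
      + sigma P n * (v * phi P (n - 1) v) + sigma_bar P * (v * phi P n v)" for v
    using phi_recurrence[OF assms, of v n] by (simp add: power2_eq_square) algebra
  have "((\<lambda>v. v\<^sup>2 * phi P n v) has_integral
      (sigma P (n + 1) * M (n + 1) + sigma P n * M (n - 1) + sigma_bar P * M n)) {v_a P..v_b P}"
    unfolding eq M_def
    by (intro has_integral_add has_integral_mult_right has_integral_times_phi assms)
  moreover have "sigma P (n + 1) * M (n + 1) + sigma P n * M (n - 1) + sigma_bar P * M n
      = (v_b P - v_a P) * second_moment P n"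
  proof -
    have "sigma P 0 = 0" by (simp add: sigma_def)
    consider "n = 0" | "n = 1" | "n = 2" | "n \<ge> 3" by linarith
    then show ?thesis
      by cases (auto simp: M_def second_moment_def power2_eq_square algebra_simps \<open>sigma P 0 = 0\<close>)
  qed
  ultimately show ?thesis by simp
qed

section \<open>Trigonometric sums and convolution\<close>

lemma continuous_on_psi [continuous_intros]:
  "continuous_on S (psi P k)"
  unfolding psi_def divide_inverse by (intro continuous_intros)

lemma psi_add: "psi P (j + k) x = psi P j x * psi P k x"
  by (simp add: psi_def exp_add[symmetric] add_divide_distrib algebra_simps)

lemma has_integral_psi:
  assumes "box_len P > 0"
  shows "(psi P k has_integral (if k = 0 then of_real (box_len P) else 0)) {0..box_len P}"
proof (cases "k = 0")
  case True
  have "((\<lambda>x. 1 :: complex) has_integral (of_real (box_len P))) {0..box_len P}"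
    using has_integral_const_real[of "1 :: complex" 0 "box_len P"] assms
    by (simp add: scaleR_conv_of_real)
  moreover have "psi P 0 = (\<lambda>x. 1)" by (rule ext) (simp add: psi_def)
  ultimately show ?thesis using True by simp
next
  case False
  define c where "c = 2 * of_real pi * \<i> * of_int k / of_real (box_len P)"
  have c: "c \<noteq> 0" using False assms by (simp add: c_def)
  have psi: "psi P k x = exp (c * of_real x)" for x
    by (simp add: psi_def c_def)
  have "((\<lambda>x. exp (c * of_real x) / c) has_vector_derivative psi P k x) (at x within {0..box_len P})" for x
  proof -
    have "((\<lambda>z. exp (c * z) / c) has_field_derivative exp (c * of_real x)) (at (of_real x))"
      by (rule derivative_eq_intros refl | use c in simp)+
    from has_vector_derivative_real_field[OF this, of "{0..box_len P}"] show ?thesis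
      by (simp add: psi o_def)
  qed
  then have "(psi P k has_integral
      (exp (c * of_real (box_len P)) / c - exp (c * of_real 0) / c)) {0..box_len P}"
    using assms by (intro fundamental_theorem_of_calculus) auto
  moreover have "exp (c * of_real (box_len P)) = 1"
  proof -
    have "c * of_real (box_len P) = 2 * of_int k * of_real pi * \<i>"
      using assms by (simp add: c_def)
    then show ?thesis using exp_integer_2pi[of "of_int k"] by simp
  qed
  ultimately show ?thesis using False by simp
qed

text \<open>The trigonometric sum with Fourier coefficients \<open>c\<close> on the retained modes.\<close>

definition trig :: "params \<Rightarrow> (int \<Rightarrow> complex) \<Rightarrow> real \<Rightarrow> complex" where
  "trig P c x = (\<Sum>k\<in>modes P. c k * psi P k x)"

lemma finite_modes [simp]: "finite (modes P)"
  by (simp add: modes_def)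

lemma uminus_modes [simp]: "- k \<in> modes P \<longleftrightarrow> k \<in> modes P"
  by (auto simp: modes_def)

lemma zero_modes [simp]: "0 \<in> modes P"
  by (simp add: modes_def)

lemma sum_modes_uminus: "(\<Sum>k\<in>modes P. g (- k)) = (\<Sum>k\<in>modes P. g k)"
  by (rule sum.reindex_bij_witness[of _ uminus uminus]) auto

lemma continuous_on_trig [continuous_intros]: "continuous_on S (trig P c)"
  unfolding trig_def by (intro continuous_intros)

lemma has_integral_trig_times_psi:
  assumes "box_len P > 0"
  shows "((\<lambda>x. trig P c x * psi P (- j) x) has_integral
           (if j \<in> modes P then of_real (box_len P) * c j else 0)) {0..box_len P}"
proof -
  have "((\<lambda>x. \<Sum>k\<in>modes P. c k * psi P (k - j) x) has_integral
      (\<Sum>k\<in>modes P. c k * (if k - j = 0 then of_real (box_len P) else 0))) {0..box_len P}"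
    by (intro has_integral_sum finite_modes has_integral_mult_right has_integral_psi assms)
  also have "(\<lambda>x. \<Sum>k\<in>modes P. c k * psi P (k - j) x) = (\<lambda>x. trig P c x * psi P (- j) x)"
    by (simp add: trig_def sum_distrib_right mult.assoc flip: psi_add)
  also have "(\<Sum>k\<in>modes P. c k * (if k - j = 0 then of_real (box_len P) else 0))
      = (\<Sum>k\<in>modes P. if k = j then of_real (box_len P) * c j else 0)"
    by (rule sum.cong) auto
  also have "\<dots> = (if j \<in> modes P then of_real (box_len P) * c j else 0)"
    by simp
  finally show ?thesis .
qed

lemma has_integral_trig:
  assumes "box_len P > 0"
  shows "(trig P c has_integral of_real (box_len P) * c 0) {0..box_len P}"
  using has_integral_trig_times_psi[OF assms, of c 0] by (simp add: psi_def)

lemma fourier_coeff_trig: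
  assumes "box_len P > 0"
  shows "fourier_coeff P (trig P c) j = (if j \<in> modes P then c j else 0)"
  using integral_unique[OF has_integral_trig_times_psi[OF assms, of c j]] assms
  by (simp add: fourier_coeff_def)

text \<open>
  Parseval's identity in bilinear form, with no complex conjugation; it holds without assuming
  that the sum is real-valued.
\<close>

lemma has_integral_trig_square:
  assumes "box_len P > 0"
  shows "((\<lambda>x. (trig P c x)\<^sup>2) has_integral
           of_real (box_len P) * (\<Sum>k\<in>modes P. c (- k) * c k)) {0..box_len P}"
proof -
  have "((\<lambda>x. \<Sum>k\<in>modes P. c (- k) * (trig P c x * psi P (- k) x)) has_integral
      (\<Sum>k\<in>modes P. c (- k) * (if k \<in> modes P then of_real (box_len P) * c k else 0))) {0..box_len P}"
    by (intro has_integral_sum finite_modes has_integral_mult_right has_integral_trig_times_psi assms)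
  also have "(\<lambda>x. \<Sum>k\<in>modes P. c (- k) * (trig P c x * psi P (- k) x)) = (\<lambda>x. (trig P c x)\<^sup>2)"
  proof
    fix x
    have "(\<Sum>k\<in>modes P. c (- k) * (trig P c x * psi P (- k) x))
        = trig P c x * (\<Sum>k\<in>modes P. c (- k) * psi P (- k) x)"
      by (simp add: sum_distrib_left mult_ac)
    also have "(\<Sum>k\<in>modes P. c (- k) * psi P (- k) x) = trig P c x"
      unfolding trig_def by (rule sum_modes_uminus)
    finally show "(\<Sum>k\<in>modes P. c (- k) * (trig P c x * psi P (- k) x)) = (trig P c x)\<^sup>2"
      by (simp add: power2_eq_square)
  qed
  also have "(\<Sum>k\<in>modes P. c (- k) * (if k \<in> modes P then of_real (box_len P) * c k else 0))
      = of_real (box_len P) * (\<Sum>k\<in>modes P. c (- k) * c k)"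
    by (simp add: sum_distrib_left mult_ac)
  finally show ?thesis .
qed

lemma fourier_coeff_cmult: "fourier_coeff P (\<lambda>x. a * g x) k = a * fourier_coeff P g k"
  by (simp add: fourier_coeff_def mult.assoc)

lemma fourier_coeff_diff:
  assumes "continuous_on UNIV g" "continuous_on UNIV h"
  shows "fourier_coeff P (\<lambda>x. g x - h x) k = fourier_coeff P g k - fourier_coeff P h k"
proof -
  have "(\<lambda>x. f x * psi P (- k) x) integrable_on {0..box_len P}" if "continuous_on UNIV f" for f
    by (intro integrable_continuous_interval continuous_intros continuous_on_subset[OF that]) simp
  from integral_diff[OF this[OF assms(1)] this[OF assms(2)]] show ?thesis
    by (simp add: fourier_coeff_def left_diff_distrib diff_divide_distrib)
qed

lemma star_cmult: "star P g (\<lambda>x. a * h x) k = a * star P g h k"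
  by (simp add: star_def fourier_coeff_cmult sum_distrib_left mult_ac)

lemma star_diff:
  assumes "continuous_on UNIV h" "continuous_on UNIV h'"
  shows "star P g (\<lambda>x. h x - h' x) k = star P g h k - star P g h' k"
  by (simp add: star_def fourier_coeff_diff assms right_diff_distrib sum_subtractf)

lemma star_trig_0:
  assumes "box_len P > 0"
  shows "star P (trig P c) (trig P d) 0 = (\<Sum>k\<in>modes P. c (- k) * d k)"
proof -
  have "star P (trig P c) (trig P d) 0 = (\<Sum>k\<in>modes P. c k * d (- k))"
    by (simp add: star_def fourier_coeff_trig assms)
  also have "\<dots> = (\<Sum>k\<in>modes P. c (- k) * d k)"
    using sum_modes_uminus[of "\<lambda>k. c k * d (- k)" P] by simp
  finally show ?thesis .
qed


section \<open>The distribution functions and the solved scheme\<close>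

lemma C_fun_eq_trig: "C_fun P C s i t = trig P (\<lambda>k. C s i k t)"
  by (rule ext) (simp add: C_fun_def trig_def)

lemma E_fun_eq_trig: "E_fun P E t = trig P (\<lambda>k. E k t)"
  by (rule ext) (simp add: E_fun_def trig_def)

lemma E_hat_eq_trig: "E_hat P E t = trig P (\<lambda>k. hat P (E k) t)"
  by (rule ext) (simp add: E_hat_def hat_def E_fun_def trig_def sum.distrib distrib_right)

lemma coupling_eq_trig:
  "(\<lambda>x. \<Sum>i<n. of_real (sigma2 P n i) * hat P (\<lambda>r. C_fun P C s (int i) r x) t)
     = trig P (\<lambda>k. \<Sum>i<n. of_real (sigma2 P n i) * hat P (C s (int i) k) t)"
proof
  fix x
  have "(\<Sum>i<n. of_real (sigma2 P n i) * hat P (\<lambda>r. C_fun P C s (int i) r x) t)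
      = (\<Sum>i<n. \<Sum>k\<in>modes P. of_real (sigma2 P n i) * hat P (C s (int i) k) t * psi P k x)"
    by (simp add: hat_def C_fun_def sum_distrib_left algebra_simps flip: sum.distrib)
  also have "\<dots> = trig P (\<lambda>k. \<Sum>i<n. of_real (sigma2 P n i) * hat P (C s (int i) k) t) x"
    unfolding trig_def sum_distrib_right by (rule sum.swap)
  finally show "(\<Sum>i<n. of_real (sigma2 P n i) * hat P (\<lambda>r. C_fun P C s (int i) r x) t)
      = trig P (\<lambda>k. \<Sum>i<n. of_real (sigma2 P n i) * hat P (C s (int i) k) t) x" .
qed

lemma continuous_on_delta_f_phi_hat: "continuous_on S (delta_f_phi_hat P C s n t)"
  unfolding delta_f_phi_hat_def delta_v_def hat_def f_fun_def C_fun_def divide_inverse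
  by (intro continuous_intros)

lemma has_integral_square_times_f_fun:
  assumes "v_a P < v_b P"
  shows "((\<lambda>v. of_real (v\<^sup>2) * f_fun P C s t x v) has_integral
     (\<Sum>n<N_L P. C_fun P C s (int n) t x * of_real ((v_b P - v_a P) * second_moment P n)))
     {v_a P..v_b P}"
proof -
  have "((\<lambda>v. \<Sum>n<N_L P. C_fun P C s (int n) t x * of_real (v\<^sup>2 * phi P n v)) has_integral
     (\<Sum>n<N_L P. C_fun P C s (int n) t x * of_real ((v_b P - v_a P) * second_moment P n)))
     {v_a P..v_b P}"
    by (intro has_integral_sum has_integral_mult_right has_integral_of_real
        has_integral_square_times_phi assms) simp
  then show ?thesis by (simp add: f_fun_def sum_distrib_left mult_ac)
qed

lemma kinetic_integral:
  assumes "v_a P < v_b P" "box_len P > 0" "N_L P \<ge> 3"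
  shows "integral {0..box_len P} (\<lambda>x. integral {v_a P..v_b P}
             (\<lambda>v. of_real (v\<^sup>2) * f_fun P C s t x v))
       = of_real (box_len P * (v_b P - v_a P)) *
           (\<Sum>n<3. of_real (second_moment P n) * C s (int n) 0 t)"
proof -
  have "((\<lambda>x. \<Sum>n<N_L P. C_fun P C s (int n) t x * of_real ((v_b P - v_a P) * second_moment P n))
     has_integral (\<Sum>n<N_L P. of_real (box_len P) * C s (int n) 0 t *
        of_real ((v_b P - v_a P) * second_moment P n))) {0..box_len P}"
    unfolding C_fun_eq_trig
    by (intro has_integral_sum has_integral_mult_left has_integral_trig assms) simp
  moreover have "(\<Sum>n<N_L P. of_real (box_len P) * C s (int n) 0 t *
        of_real ((v_b P - v_a P) * second_moment P n))
     = (\<Sum>n<3. of_real (box_len P) * C s (int n) 0 t *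
        of_real ((v_b P - v_a P) * second_moment P n))"
    using assms(3) by (intro sum.mono_neutral_right) (auto simp: second_moment_def)
  ultimately show ?thesis
    unfolding integral_unique[OF has_integral_square_times_f_fun[OF assms(1)]]
    by (simp add: integral_unique sum_distrib_left mult_ac)
qed

text \<open>The scheme solved for the new coefficients, with the convolution split into coupling and penalty.\<close>

lemma crank_nicolson_step:
  assumes "admissible P" "crank_nicolson P C E t" "n < N_L P" "k \<in> modes P"
  shows "C s (int n) k (t + dt P) - C s (int n) k t = of_real (dt P) *
     (1 / 2 * of_real (coll_coeff P s n) * hat P (C s (int n) k) t
      - wavenum P k / 2 *
            (of_real (sigma P (n + 1)) * hat P (C s (int n + 1) k) t
             + of_real (sigma P n) * hat P (C s (int n - 1) k) t
             + of_real (sigma_bar P) * hat P (C s (int n) k) t)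
      + of_real (charge P s / (4 * mass P s)) *
          (star P (E_hat P E t)
             (trig P (\<lambda>k. \<Sum>i<n. of_real (sigma2 P n i) * hat P (C s (int i) k) t)) k
           - of_real (penalty P s) * star P (E_hat P E t) (delta_f_phi_hat P C s n t) k))"
proof -
  define A where "A = of_real (sigma P (n + 1)) * hat P (C s (int n + 1) k) t
             + of_real (sigma P n) * hat P (C s (int n - 1) k) t
             + of_real (sigma_bar P) * hat P (C s (int n) k) t"
  define B where "B = star P (E_hat P E t)
             (trig P (\<lambda>k. \<Sum>i<n. of_real (sigma2 P n i) * hat P (C s (int i) k) t)) k
           - of_real (penalty P s) * star P (E_hat P E t) (delta_f_phi_hat P C s n t) k"
  have star: "star P (E_hat P E t)
              (\<lambda>x. (\<Sum>i<n. of_real (sigma2 P n i) * hat P (\<lambda>r. C_fun P C s (int i) r x) t)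
                   - of_real (penalty P s) * delta_f_phi_hat P C s n t x) k = B"
    unfolding B_def coupling_eq_trig[symmetric]
  proof (subst star_diff)
    show "continuous_on UNIV (\<lambda>x. \<Sum>i<n. of_real (sigma2 P n i) *
        hat P (\<lambda>r. C_fun P C s (int i) r x) t)"
      unfolding coupling_eq_trig by (rule continuous_on_trig)
    show "continuous_on UNIV (\<lambda>x. of_real (penalty P s) * delta_f_phi_hat P C s n t x)"
      by (intro continuous_intros continuous_on_delta_f_phi_hat)
  qed (simp add: star_cmult)
  have scheme: "(C s (int n) k (t + dt P) - C s (int n) k t) / of_real (dt P)
        + of_real pi * \<i> / of_real (box_len P) * of_int k * A
        - of_real (charge P s / (4 * mass P s)) * B
        = 1 / 2 * of_real (coll_coeff P s n) * hat P (C s (int n) k) t"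
    using assms(2-4) unfolding crank_nicolson_def star[symmetric] A_def by blast
  have wavenum: "of_real pi * \<i> / of_real (box_len P) * of_int k = wavenum P k / 2"
    by (simp add: wavenum_def)
  have solve: "X = R - Y + Z" if "X + Y - Z = R" for X Y Z R :: complex
    using that by auto
  have "(C s (int n) k (t + dt P) - C s (int n) k t) / of_real (dt P)
      = 1 / 2 * of_real (coll_coeff P s n) * hat P (C s (int n) k) t
        - wavenum P k / 2 * A + of_real (charge P s / (4 * mass P s)) * B"
    by (rule solve[OF scheme[unfolded wavenum]])
  moreover have "of_real (dt P) \<noteq> (0 :: complex)"
    using assms(1) by (simp add: admissible_def)
  ultimately show ?thesis
    unfolding A_def[symmetric] B_def[symmetric] by (simp add: field_simps)
qed

section \<open>Energy exchange between particles and field\<close>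

text \<open>
  The mode \<open>k\<close> of the flux of the zeroth Legendre mode, summed over the two times: the
  coefficient of \<open>\<phi>_0\<close> in \<open>v f\<close>. The charge of the species is not included.
\<close>

definition current :: "params \<Rightarrow> legendre_coeffs \<Rightarrow> species \<Rightarrow> int \<Rightarrow> real \<Rightarrow> complex" where
  "current P C s k t = of_real (sigma P 1) * hat P (C s 1 k) t + of_real (sigma_bar P) * hat P (C s 0 k) t"

text \<open>The rate of work of the electric field on one species, which is what the two balances exchange.\<close>

definition field_work :: "params \<Rightarrow> legendre_coeffs \<Rightarrow> field_coeffs \<Rightarrow> species \<Rightarrow> real \<Rightarrow> complex" where
  "field_work P C E s t = of_real (charge P s * box_len P * (v_b P - v_a P) / 4) *
     (\<Sum>k\<in>modes P. hat P (E (- k)) t * current P C s k t)"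

lemma sigma_sigma2:
  assumes "v_a P < v_b P"
  shows "sigma P 1 * sigma2 P 1 0 = 1" "sigma P 2 * sigma2 P 2 1 = 2" "sigma2 P 2 0 = 0"
proof -
  have "sqrt 15 * sqrt 15 = (15 :: real)" by simp
  moreover have "sqrt 5 * sqrt 3 = (sqrt 15 :: real)" by (simp flip: real_sqrt_mult)
  ultimately show "sigma P 1 * sigma2 P 1 0 = 1" "sigma P 2 * sigma2 P 2 1 = 2" "sigma2 P 2 0 = 0"
    using assms by (auto simp: sigma_def sigma2_def field_simps)
qed

lemma kinetic_balance:
  assumes adm: "admissible P" and cn: "crank_nicolson P C E t"
  defines "K \<equiv> \<lambda>r s. of_real (mass P s / 2) * integral {0..box_len P} (\<lambda>x. integral {v_a P..v_b P}
             (\<lambda>v. of_real (v\<^sup>2) * f_fun P C s r x v))"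
  shows "K (t + dt P) s - K t s = of_real (dt P) * (of_real (1 / 2) * B_kin P C E s t + field_work P C E s t)"
proof -
  have P: "box_len P > 0" "v_a P < v_b P" "N_L P \<ge> 4" "mass P s > 0"
    using adm by (auto simp: admissible_def)
  define T where "T n = star P (E_hat P E t)
     (trig P (\<lambda>k. \<Sum>i<n. of_real (sigma2 P n i) * hat P (C s (int i) k) t)) 0" for n :: nat
  define G where "G n = star P (E_hat P E t) (delta_f_phi_hat P C s n t) 0" for n
  define S where "S i = (\<Sum>k\<in>modes P. hat P (E (- k)) t * hat P (C s i k) t)" for i
  have T: "T n = (\<Sum>i<n. of_real (sigma2 P n i) * S (int i))" for n
  proof -
    have "T n = (\<Sum>k\<in>modes P. hat P (E (- k)) t * (\<Sum>i<n. of_real (sigma2 P n i) * hat P (C s (int i) k) t))"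
      unfolding T_def E_hat_eq_trig by (rule star_trig_0) (rule P)
    also have "\<dots> = (\<Sum>i<n. of_real (sigma2 P n i) * S (int i))"
      unfolding S_def sum_distrib_left by (subst sum.swap) (simp add: mult_ac)
    finally show ?thesis .
  qed
  have step: "C s (int n) 0 (t + dt P) - C s (int n) 0 t =
      of_real (dt P * charge P s / (4 * mass P s)) * (T n - of_real (penalty P s) * G n)"
    if "n < 3" for n
  proof -
    have "coll_coeff P s n = 0"
      using that by (auto simp: coll_coeff_def less_Suc_eq numeral_3_eq_3)
    then show ?thesis
      using crank_nicolson_step[OF adm cn, of n 0 s] that P(3)
      by (simp add: wavenum_def T_def G_def)
  qed
  have "K (t + dt P) s - K t s = of_real (mass P s / 2 * (box_len P * (v_b P - v_a P))) *
      (\<Sum>n<3. of_real (second_moment P n) * (C s (int n) 0 (t + dt P) - C s (int n) 0 t))"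
  proof -
    have "N_L P \<ge> 3" using P by simp
    note integral = kinetic_integral[OF P(2,1) this]
    have factor: "a * (b * x) - a * (b * y) = a * b * (x - y)" for a b x y :: complex
      by (simp add: algebra_simps)
    show ?thesis
      unfolding K_def integral right_diff_distrib[of "of_real (second_moment P _)"] sum_subtractf
        of_real_mult[of "mass P s / 2" "box_len P * (v_b P - v_a P)"]
      by (rule factor)
  qed
  also have "(\<Sum>n<3. of_real (second_moment P n) * (C s (int n) 0 (t + dt P) - C s (int n) 0 t))
      = (\<Sum>n<3. of_real (second_moment P n) *
          (of_real (dt P * charge P s / (4 * mass P s)) * (T n - of_real (penalty P s) * G n)))"
    by (rule sum.cong) (simp_all add: step)
  also have "\<dots> = of_real (dt P * charge P s / (4 * mass P s)) *
      ((\<Sum>n<3. of_real (second_moment P n) * T n)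
        - of_real (penalty P s) * (\<Sum>n<3. of_real (second_moment P n) * G n))"
    by (simp add: sum_distrib_left right_diff_distrib sum_subtractf diff_divide_distrib
        sum_divide_distrib mult_ac)
  finally have raw: "K (t + dt P) s - K t s = of_real (mass P s / 2 * (box_len P * (v_b P - v_a P))) *
      (of_real (dt P * charge P s / (4 * mass P s)) *
      ((\<Sum>n<3. of_real (second_moment P n) * T n)
        - of_real (penalty P s) * (\<Sum>n<3. of_real (second_moment P n) * G n)))" .
  have coeff: "mass P s / 2 * (box_len P * (v_b P - v_a P)) * (dt P * charge P s / (4 * mass P s))
      = dt P * charge P s * box_len P * (v_b P - v_a P) / 8"
    using P(4) by (simp add: field_simps)
  have diff: "K (t + dt P) s - K t s =
      of_real (dt P * charge P s * box_len P * (v_b P - v_a P) / 8) *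
      ((\<Sum>n<3. of_real (second_moment P n) * T n)
        - of_real (penalty P s) * (\<Sum>n<3. of_real (second_moment P n) * G n))"
    by (simp only: raw coeff[symmetric] of_real_mult[of "mass P s / 2 * (box_len P * (v_b P - v_a P))"]
        mult.assoc[of "of_real (mass P s / 2 * (box_len P * (v_b P - v_a P)))"])
  have sum2: "(\<Sum>n<2. h n) = h 0 + h 1" and sum3: "(\<Sum>n<3. h n) = h 0 + h 1 + h 2"
    for h :: "nat \<Rightarrow> complex"
    by (simp_all add: eval_nat_numeral)
  have work: "(\<Sum>n<3. of_real (second_moment P n) * T n)
      = 2 * (\<Sum>k\<in>modes P. hat P (E (- k)) t * current P C s k t)"
  proof -
    have "(\<Sum>n<3. of_real (second_moment P n) * T n)
        = of_real (2 * sigma_bar P * (sigma P 1 * sigma2 P 1 0)) * S 0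
          + of_real (sigma P 1 * (sigma P 2 * sigma2 P 2 1)) * S 1"
    proof -
      have "T 0 = 0" "T 1 = of_real (sigma2 P 1 0) * S 0"
        by (simp_all add: T)
      moreover have "T 2 = of_real (sigma2 P 2 1) * S 1"
        unfolding T sum2 by (simp add: sigma_sigma2(3)[OF P(2)])
      ultimately show ?thesis
        unfolding sum3 by (simp add: second_moment_def algebra_simps)
    qed
    also have "\<dots> = 2 * (of_real (sigma_bar P) * S 0 + of_real (sigma P 1) * S 1)"
      by (simp only: sigma_sigma2(1,2)[OF P(2)]) (simp add: algebra_simps)
    also have "of_real (sigma_bar P) * S 0 + of_real (sigma P 1) * S 1
        = (\<Sum>k\<in>modes P. hat P (E (- k)) t * current P C s k t)"
      by (simp add: S_def current_def sum_distrib_left algebra_simps flip: sum.distrib)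
    finally show ?thesis .
  qed
  have bdry: "B_kin P C E s t =
      - of_real (penalty P s * (charge P s / 4) * (v_b P - v_a P) * box_len P) *
        (\<Sum>n<3. of_real (second_moment P n) * G n)"
  proof -
    have factor: "a * (c * x) + b * (c * y) + d * (c * z) = c * (d * z + b * y + a * x)"
      for a b c d x y z :: complex
      by (simp add: algebra_simps)
    have weights: "second_moment P 0 = (sigma P 1)\<^sup>2 + (sigma P 0)\<^sup>2 + (sigma_bar P)\<^sup>2"
        "second_moment P 1 = 2 * sigma P 1 * sigma_bar P" "second_moment P 2 = sigma P 2 * sigma P 1"
      by (simp_all add: second_moment_def)
    show ?thesis
      unfolding sum3 B_kin_def B_mode0_def G_def weights by (rule factor)
  qed
  show ?thesis
    unfolding diff work bdry field_work_def by (simp add: field_simps)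
qed

text \<open>
  A discrete Ampere law. The mode \<open>k = 0\<close> is excluded, since Poisson's equation does not determine
  the mean field.
\<close>

lemma ampere:
  assumes adm: "admissible P" and st: "discrete_state P C E t" "discrete_state P C E (t + dt P)"
    and cn: "crank_nicolson P C E t" and k: "k \<in> modes P" "k \<noteq> 0"
  shows "of_real (eps0 P) * (E k (t + dt P) - E k t) =
     of_real (dt P * (v_b P - v_a P)) * (\<Sum>s\<in>{Electron, Ion}. of_real (charge P s) *
        (B_Amp P C E s t k - current P C s k t / 2))"
proof -
  have kappa: "wavenum P k \<noteq> 0"
    using adm k by (simp add: wavenum_def admissible_def)
  have charge: "C s 0 k (t + dt P) - C s 0 k t =
      of_real (dt P) * wavenum P k * (B_Amp P C E s t k - current P C s k t / 2)" for s
  proof -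
    \<comment> \<open>For \<open>n = 0\<close> the coupling sum over \<open>i < n\<close> is empty.\<close>
    have star0: "star P (E_hat P E t) (trig P (\<lambda>k. 0)) k = 0"
    proof -
      have "trig P (\<lambda>k. 0) = (\<lambda>x. 0)" by (rule ext) (simp add: trig_def)
      then show ?thesis using star_cmult[of P "E_hat P E t" 0 "\<lambda>x. 0" k] by simp
    qed
    have "B_Amp P C E s t k = - (of_real (charge P s / (4 * mass P s)) * inverse (wavenum P k) *
        (of_real (penalty P s) * star P (E_hat P E t) (delta_f_phi_hat P C s 0 t) k))"
      unfolding B_Amp_def star_cmult delta_f_phi_hat_def by simp
    moreover have "0 < N_L P" "coll_coeff P s 0 = 0" "sigma P 0 = 0"
      using adm by (auto simp: admissible_def coll_coeff_def sigma_def)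
    ultimately show ?thesis
      using crank_nicolson_step[OF adm cn, of 0 k s] k(1) kappa star0
      by (simp add: current_def field_simps)
  qed
  have "wavenum P k * (of_real (eps0 P) * (E k (t + dt P) - E k t)) =
      of_real (v_b P - v_a P) * (\<Sum>s\<in>{Electron, Ion}. of_real (charge P s) * (C s 0 k (t + dt P) - C s 0 k t))"
  proof -
    have "of_real (eps0 P) * wavenum P k * E k r =
        of_real (v_b P - v_a P) * (\<Sum>s\<in>{Electron, Ion}. of_real (charge P s) * C s 0 k r)"
      if "discrete_state P C E r" for r
      using that k(1) unfolding discrete_state_def by blast
    from this[OF st(1)] this[OF st(2)] show ?thesis
      by (simp add: algebra_simps)
  qed
  also have "\<dots> = wavenum P k * (of_real (dt P * (v_b P - v_a P)) *
      (\<Sum>s\<in>{Electron, Ion}. of_real (charge P s) * (B_Amp P C E s t k - current P C s k t / 2)))"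
    unfolding charge by (simp add: algebra_simps)
  finally show ?thesis using kappa by simp
qed

lemma field_balance:
  assumes adm: "admissible P" and st: "discrete_state P C E t" "discrete_state P C E (t + dt P)"
    and cn: "crank_nicolson P C E t"
  defines "U \<equiv> \<lambda>r. of_real (eps0 P / 2) * integral {0..box_len P} (\<lambda>x. (E_fun P E r x)\<^sup>2)"
  shows "U (t + dt P) - U t = of_real (dt P) * (\<Sum>s\<in>{Electron, Ion}.
      of_real (charge P s * box_len P * (v_b P - v_a P) / 2) * B_pot P C E s t - field_work P C E s t)"
proof -
  have L: "box_len P > 0" using adm by (simp add: admissible_def)
  define d where "d k = E k (t + dt P) - E k t" for k
  have U: "U r = of_real (eps0 P * box_len P / 2) * (\<Sum>k\<in>modes P. E (- k) r * E k r)" for r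
    using integral_unique[OF has_integral_trig_square[OF L, of "\<lambda>k. E k r"]]
    by (simp add: U_def E_fun_eq_trig)
  \<comment> \<open>Difference of squares; the mixed terms cancel under the reflection \<open>k \<mapsto> - k\<close> of the modes.\<close>
  have "(\<Sum>k\<in>modes P. E (- k) (t + dt P) * E k (t + dt P)) - (\<Sum>k\<in>modes P. E (- k) t * E k t)
      = (\<Sum>k\<in>modes P. hat P (E (- k)) t * d k)"
  proof -
    have "(\<Sum>k\<in>modes P. E (- k) (t + dt P) * E k t) = (\<Sum>k\<in>modes P. E (- k) t * E k (t + dt P))"
      using sum_modes_uminus[of "\<lambda>k. E (- k) t * E k (t + dt P)" P] by (simp add: mult.commute)
    then show ?thesis
      by (simp add: hat_def d_def algebra_simps sum.distrib sum_subtractf)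
  qed
  then have "U (t + dt P) - U t = of_real (box_len P / 2) *
      (\<Sum>k\<in>modes P. hat P (E (- k)) t * (of_real (eps0 P) * d k))"
    unfolding U right_diff_distrib[symmetric]
    by (simp add: sum_distrib_left mult_ac)
  also have "(\<Sum>k\<in>modes P. hat P (E (- k)) t * (of_real (eps0 P) * d k))
      = (\<Sum>k\<in>modes P. hat P (E (- k)) t * (of_real (dt P * (v_b P - v_a P)) *
          (\<Sum>s\<in>{Electron, Ion}. of_real (charge P s) * (B_Amp P C E s t k - current P C s k t / 2))))"
  proof (rule sum.cong)
    fix k assume k: "k \<in> modes P"
    show "hat P (E (- k)) t * (of_real (eps0 P) * d k) =
       hat P (E (- k)) t * (of_real (dt P * (v_b P - v_a P)) *
          (\<Sum>s\<in>{Electron, Ion}. of_real (charge P s) * (B_Amp P C E s t k - current P C s k t / 2)))"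
    proof (cases "k = 0")
      case True
      \<comment> \<open>\<open>E 0\<close> is zero at both times.\<close>
      then show ?thesis using st by (simp add: hat_def discrete_state_def)
    next
      case False
      then show ?thesis unfolding d_def using ampere[OF adm st cn k] by simp
    qed
  qed simp
  also have "\<dots> = of_real (dt P * (v_b P - v_a P)) *
      (\<Sum>s\<in>{Electron, Ion}. of_real (charge P s) *
        (\<Sum>k\<in>modes P. hat P (E (- k)) t * (B_Amp P C E s t k - current P C s k t / 2)))"
    unfolding sum_distrib_left by (subst sum.swap) (simp add: mult_ac)
  also have "(\<lambda>s. \<Sum>k\<in>modes P. hat P (E (- k)) t * (B_Amp P C E s t k - current P C s k t / 2))
      = (\<lambda>s. B_pot P C E s t - (\<Sum>k\<in>modes P. hat P (E (- k)) t * current P C s k t) / 2)"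
    by (simp add: B_pot_def right_diff_distrib sum_subtractf sum_divide_distrib flip: mult_2)
  also have "of_real (box_len P / 2) * (of_real (dt P * (v_b P - v_a P)) *
      (\<Sum>s\<in>{Electron, Ion}. of_real (charge P s) *
        (B_pot P C E s t - (\<Sum>k\<in>modes P. hat P (E (- k)) t * current P C s k t) / 2)))
    = of_real (dt P) * (\<Sum>s\<in>{Electron, Ion}.
        of_real (charge P s * box_len P * (v_b P - v_a P) / 2) * B_pot P C E s t - field_work P C E s t)"
    by (simp add: field_work_def field_simps)
  finally show ?thesis .
qed

theorem mainTheorem9:
  fixes P :: params and C :: legendre_coeffs and E :: field_coeffs and t :: real
  assumes "admissible P"
    and "discrete_state P C E t"
    and "discrete_state P C E (t + dt P)"
    and "crank_nicolson P C E t"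
  shows "total_energy P C E (t + dt P) - total_energy P C E t =
      of_real (dt P) * (\<Sum>s\<in>{Electron, Ion}. of_real (1 / 2) * B_kin P C E s t)
    + of_real (dt P) * (\<Sum>s\<in>{Electron, Ion}.
        of_real (charge P s * box_len P * (v_b P - v_a P) / 2) * B_pot P C E s t)"
proof -
  note kin = kinetic_balance[OF assms(1,4)]
  note pot = field_balance[OF assms]
  have split: "total_energy P C E (t + dt P) - total_energy P C E t =
     (of_real (dt P) * (of_real (1 / 2) * B_kin P C E Electron t + field_work P C E Electron t)
      + of_real (dt P) * (of_real (1 / 2) * B_kin P C E Ion t + field_work P C E Ion t))
     + of_real (dt P) * (\<Sum>s\<in>{Electron, Ion}.
        of_real (charge P s * box_len P * (v_b P - v_a P) / 2) * B_pot P C E s t - field_work P C E s t)"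
    unfolding kin[of Electron, symmetric] kin[of Ion, symmetric] pot[symmetric] total_energy_def
    by simp
  show ?thesis
    unfolding split by (simp add: algebra_simps)
qed

end
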